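(* Let $W$ be the Weyl group of a Cartan matrix of finite type with index set $I$, and let $c$ be a Coxeter element of $W$. If $i,j\in I$ satisfy $i\prec_c j$ then $$h(i;c)-h(j;c)=\begin{cases}1 & \text{if } j^\star\prec_c i^\star;\\ 0 & \text{if } i^\star\prec_c j^\star.\end{cases}$$
   Context: $A=(a_{i,j})_{i,j\in I}$ is a Cartan matrix of finite type with simple roots $\alpha_i$, fundamental weights $\omega_i$ ($\alpha_j=\sum_i a_{i,j}\omega_i$), and Weyl group $W$ generated by simple reflections $s_i$, $s_i\alpha_j=\alpha_j-a_{i,j}\alpha_i$. A Coxeter element is a product of all simple reflections, each once, in some order. Write $i\prec_c j$ if $i\neq j$, $a_{i,j}\ne0$, and $s_i$ precedes $s_j$ in the factorization of $c$. The involution $i\mapsto i^\star$ of $I$ is defined by $\omega_{i^\star}=-w_\circ(\omega_i)$, with $w_\circ$ the longest element of $W$. Weights are ordered by $\gamma\ge\delta$ iff $\gamma-\delta$ is a nonnegative integer combination of simple roots, and $h(i;c)$ is the (unique) positive integer with $\omega_i>c\,\omega_i>\cdots>c^{h(i;c)}\omega_i=-\omega_{i^\star}$. *)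

theory Defs
  imports "HOL-Analysis.Analysis"
begin

definition cartan_matrix :: "int ^ 'i ^ 'i \<Rightarrow> bool" where
  "cartan_matrix A \<longleftrightarrow>
     (\<forall>i. A $ i $ i = 2) \<and>
     (\<forall>i j. i \<noteq> j \<longrightarrow> A $ i $ j \<le> 0) \<and>
     (\<forall>i j. A $ i $ j = 0 \<longleftrightarrow> A $ j $ i = 0)"

text \<open>Finite type: some positive diagonal matrix \<open>diag(d)\<close> makes \<open>diag(d) A\<close> symmetric
  and positive definite.  The matrix may be decomposable.\<close>

definition finite_type :: "int ^ 'i ^ 'i::finite \<Rightarrow> bool" where
  "finite_type A \<longleftrightarrow> cartan_matrix A \<and>
     (\<exists>d :: 'i \<Rightarrow> real.
        (\<forall>i. d i > 0) \<and>
        (\<forall>i j. d i * of_int (A $ i $ j) = d j * of_int (A $ j $ i)) \<and>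
        (\<forall>x :: real ^ 'i. x \<noteq> 0 \<longrightarrow>
           (\<Sum>i\<in>UNIV. \<Sum>j\<in>UNIV. d i * of_int (A $ i $ j) * x $ i * x $ j) > 0))"

text \<open>Weights are written in coordinates with respect to the fundamental weights,
  so the weight lattice is \<^typ>\<open>int ^ 'i\<close>.\<close>

definition fund_weight :: "'i \<Rightarrow> int ^ 'i::finite" where
  "fund_weight i = axis i 1"

definition simple_root :: "int ^ 'i ^ 'i \<Rightarrow> 'i \<Rightarrow> int ^ 'i::finite" where
  "simple_root A j = (\<Sum>i\<in>UNIV. A $ i $ j *s fund_weight i)"

text \<open>The linear map with \<open>\<omega>\<^sub>j \<mapsto> \<omega>\<^sub>j - \<delta>\<^sub>i\<^sub>j \<alpha>\<^sub>i\<close>.  For finite type the simple roots span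
  the weight space rationally, so it is the only linear map satisfying
  \<open>simple_reflection_simple_root\<close> below.\<close>

definition simple_reflection :: "int ^ 'i ^ 'i \<Rightarrow> 'i \<Rightarrow> int ^ 'i \<Rightarrow> int ^ 'i::finite" where
  "simple_reflection A i \<gamma> = \<gamma> - \<gamma> $ i *s simple_root A i"

lemma simple_root_nth: "simple_root A j $ i = A $ i $ j"
proof -
  have "simple_root A j $ i = (\<Sum>k\<in>UNIV. if k = i then A $ k $ j else 0)"
    unfolding simple_root_def fund_weight_def sum_component
    by (intro sum.cong refl) (auto simp: axis_def)
  then show ?thesis by simp
qed

lemma simple_reflection_simple_root:
  "simple_reflection A i (simple_root A j) = simple_root A j - A $ i $ j *s simple_root A i"
  by (simp add: simple_reflection_def simple_root_nth)

lemma simple_reflection_add: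
  "simple_reflection A i (\<gamma> + \<delta>) = simple_reflection A i \<gamma> + simple_reflection A i \<delta>"
  by (simp add: simple_reflection_def vec_eq_iff algebra_simps)

lemma simple_reflection_fund_weight:
  "simple_reflection A i (fund_weight j) =
     (if i = j then fund_weight j - simple_root A i else fund_weight j)"
  by (auto simp: simple_reflection_def fund_weight_def axis_def vec_eq_iff)

text \<open>\<open>word_elt A [i\<^sub>1, \<dots>, i\<^sub>n]\<close> is the product \<open>s\<^bsub>i\<^sub>1\<^esub> \<cdots> s\<^bsub>i\<^sub>n\<^esub>\<close>; the last factor acts first.\<close>

definition word_elt :: "int ^ 'i ^ 'i \<Rightarrow> 'i list \<Rightarrow> int ^ 'i \<Rightarrow> int ^ 'i::finite" where
  "word_elt A ws = foldr (\<lambda>i w. simple_reflection A i \<circ> w) ws id"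

text \<open>Simple reflections are involutions, so products of them already form a group.\<close>

definition weyl_group :: "int ^ 'i ^ 'i \<Rightarrow> (int ^ 'i \<Rightarrow> int ^ 'i::finite) set" where
  "weyl_group A = range (word_elt A)"

definition weyl_length :: "int ^ 'i ^ 'i \<Rightarrow> (int ^ 'i \<Rightarrow> int ^ 'i::finite) \<Rightarrow> nat" where
  "weyl_length A w = (LEAST n. \<exists>ws. length ws = n \<and> word_elt A ws = w)"

definition longest_elt :: "int ^ 'i ^ 'i \<Rightarrow> int ^ 'i \<Rightarrow> int ^ 'i::finite" where
  "longest_elt A = (THE w. w \<in> weyl_group A \<and>
     (\<forall>v\<in>weyl_group A. weyl_length A v \<le> weyl_length A w))"

definition star :: "int ^ 'i ^ 'i \<Rightarrow> 'i \<Rightarrow> 'i::finite" where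
  "star A i = (THE k. fund_weight k = - longest_elt A (fund_weight i))"

definition coxeter_factorization ::
    "int ^ 'i ^ 'i \<Rightarrow> (int ^ 'i \<Rightarrow> int ^ 'i::finite) \<Rightarrow> 'i list \<Rightarrow> bool" where
  "coxeter_factorization A c ws \<longleftrightarrow> distinct ws \<and> set ws = UNIV \<and> c = word_elt A ws"

definition coxeter_element :: "int ^ 'i ^ 'i \<Rightarrow> (int ^ 'i \<Rightarrow> int ^ 'i::finite) \<Rightarrow> bool" where
  "coxeter_element A c \<longleftrightarrow> (\<exists>ws. coxeter_factorization A c ws)"

text \<open>All factorizations of \<open>c\<close> agree up to commutations, so for \<open>a\<^sub>i\<^sub>j \<noteq> 0\<close> the relative
  order of \<open>i\<close> and \<open>j\<close> does not depend on the factorization.\<close>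

definition cox_prec ::
    "int ^ 'i ^ 'i \<Rightarrow> (int ^ 'i \<Rightarrow> int ^ 'i::finite) \<Rightarrow> 'i \<Rightarrow> 'i \<Rightarrow> bool" where
  "cox_prec A c i j \<longleftrightarrow> i \<noteq> j \<and> A $ i $ j \<noteq> 0 \<and>
     (\<exists>ws p q. coxeter_factorization A c ws \<and>
        p < q \<and> q < length ws \<and> ws ! p = i \<and> ws ! q = j)"

definition weight_ge :: "int ^ 'i ^ 'i \<Rightarrow> int ^ 'i \<Rightarrow> int ^ 'i::finite \<Rightarrow> bool" where
  "weight_ge A \<gamma> \<delta> \<longleftrightarrow>
     (\<exists>n :: 'i \<Rightarrow> nat. \<gamma> - \<delta> = (\<Sum>i\<in>UNIV. int (n i) *s simple_root A i))"

definition weight_gt :: "int ^ 'i ^ 'i \<Rightarrow> int ^ 'i \<Rightarrow> int ^ 'i::finite \<Rightarrow> bool" where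
  "weight_gt A \<gamma> \<delta> \<longleftrightarrow> weight_ge A \<gamma> \<delta> \<and> \<gamma> \<noteq> \<delta>"

definition cox_h :: "int ^ 'i ^ 'i \<Rightarrow> (int ^ 'i \<Rightarrow> int ^ 'i::finite) \<Rightarrow> 'i \<Rightarrow> nat" where
  "cox_h A c i = (THE m. m > 0 \<and>
     (\<forall>k<m. weight_gt A ((c ^^ k) (fund_weight i)) ((c ^^ Suc k) (fund_weight i))) \<and>
     (c ^^ m) (fund_weight i) = - fund_weight (star A i))"

end

theory Submission
  imports Defs
begin

text \<open>
  Put \<open>\<beta>\<^sub>k = \<omega>\<^sub>k - c \<omega>\<^sub>k\<close>.  These are the positive roots made negative by \<open>c\<^sup>-\<^sup>1\<close>, and the positive
  roots made negative by \<open>c\<close> are sent to the \<open>- \<beta>\<^sub>t\<close>.  Hence at the first \<open>m\<close> for which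
  \<open>c\<^sup>m \<beta>\<^sub>k\<close> is negative it equals some \<open>- \<beta>\<^sub>t\<close>, so \<open>c\<^sup>m \<omega>\<^sub>k = - \<omega>\<^sub>t\<close> because \<open>c\<close> has no nonzero fixed
  vector; uniqueness of the antidominant weight in an orbit gives \<open>t = k\<^sup>\<star>\<close> and \<open>m = h(k; c)\<close>.

  Let \<open>i\<close> precede \<open>j\<close>.  The coefficient of \<open>\<alpha>\<^sub>i\<close> in \<open>\<beta>\<^sub>j\<close> is positive, that is
  \<open>(\<omega>\<^sub>i, \<beta>\<^sub>j) > 0\<close>; applying \<open>c\<^sup>m\<close> with \<open>m = h(i; c)\<close> gives \<open>(- \<omega>\<^bsub>i\<star>\<^esub>, c\<^sup>m \<beta>\<^sub>j) > 0\<close>, so \<open>c\<^sup>m \<beta>\<^sub>j\<close> is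
  negative and \<open>h(j; c) \<le> h(i; c)\<close>.  Likewise \<open>(\<omega>\<^sub>j, c \<beta>\<^sub>i) > 0\<close> gives \<open>h(i; c) \<le> h(j; c) + 1\<close>.
  When the first bound is attained, \<open>(\<omega>\<^bsub>i\<star>\<^esub>, \<beta>\<^bsub>j\<star>\<^esub>) > 0\<close>, so \<open>i\<^sup>\<star>\<close> precedes \<open>j\<^sup>\<star>\<close>; when the second is
  attained, \<open>j\<^sup>\<star>\<close> precedes \<open>i\<^sup>\<star>\<close>.
\<close>

section \<open>Integral roots of a positive definite Cartan matrix\<close>

text \<open>Off the diagonal the terms at \<open>(i, j)\<close> and \<open>(j, i)\<close> pair up to
  even numbers.\<close>

lemma even_symmetric_double_sum:
  fixes t :: "'a \<Rightarrow> 'a \<Rightarrow> int"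
  assumes "finite S" and "\<And>i j. t i j = t j i" and "\<And>i. even (t i i)"
  shows "even (\<Sum>i\<in>S. \<Sum>j\<in>S. t i j)"
  using assms(1)
proof (induction S)
  case (insert a S)
  have "(\<Sum>i\<in>S. t i a) = (\<Sum>j\<in>S. t a j)"
    by (rule sum.cong) (rule refl, rule assms(2))
  then have "(\<Sum>i\<in>insert a S. \<Sum>j\<in>insert a S. t i j) =
      t a a + 2 * (\<Sum>j\<in>S. t a j) + (\<Sum>i\<in>S. \<Sum>j\<in>S. t i j)"
    using insert.hyps by (simp add: sum.distrib)
  then show ?case using insert.IH assms(3) by simp
qed simp

lemma finite_bounded_int_vec: "finite {x :: int ^ 'i::finite. \<forall>i. \<bar>x $ i\<bar> \<le> K}"
proof -
  have "{x :: int ^ 'i. \<forall>i. \<bar>x $ i\<bar> \<le> K} \<subseteq> vec_lambda ` (UNIV \<rightarrow>\<^sub>E {-K..K})"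
  proof
    fix x :: "int ^ 'i" assume "x \<in> {x. \<forall>i. \<bar>x $ i\<bar> \<le> K}"
    then have "vec_nth x \<in> UNIV \<rightarrow>\<^sub>E {-K..K}" by (auto simp: abs_le_iff)
       (metis minus_le_iff)
    then show "x \<in> vec_lambda ` (UNIV \<rightarrow>\<^sub>E {-K..K})"
      by (metis image_eqI vec_nth_inverse)
  qed
  then show ?thesis
    by (rule finite_subset) (intro finite_imageI finite_PiE; simp)
qed

text \<open>This is \<open>finite_type\<close> with one symmetrizer \<open>d\<close> fixed, so that
  the invariant form can be defined from it.\<close>

locale finite_cartan =
  fixes A :: "int ^ 'i ^ 'i::finite" and d :: "'i \<Rightarrow> real"
  assumes cartan: "cartan_matrix A"
    and d_pos: "\<And>i. d i > 0"
    and symmetrizer: "\<And>i j. d i * of_int (A $ i $ j) = d j * of_int (A $ j $ i)"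
    and pos_def: "\<And>x :: real ^ 'i. x \<noteq> 0 \<Longrightarrow>
      0 < (\<Sum>i\<in>UNIV. \<Sum>j\<in>UNIV. d i * of_int (A $ i $ j) * x $ i * x $ j)"
begin

text \<open>A vector is read either as a weight in fundamental-weight coordinates, where \<open>e i\<close> is
  \<open>\<omega>\<^sub>i\<close>, or as the coefficient vector of an element of the root lattice, where \<open>e i\<close> is \<open>\<alpha>\<^sub>i\<close>;
  multiplication by \<open>A\<close> takes the second reading to the first.  In \<open>pairing \<gamma> x\<close> the first
  argument is a weight and the second a coefficient vector.\<close>

abbreviation e :: "'i \<Rightarrow> int ^ 'i" where "e i \<equiv> axis i 1"

text \<open>This is \<open>simple_reflection\<close> in root coordinates; \<open>A_reflect\<close>
  relates the two. Weights need not lie in the root lattice, hence two parallel actions.\<close>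

definition reflect :: "'i \<Rightarrow> int ^ 'i \<Rightarrow> int ^ 'i" where
  "reflect i x = x - (A *v x) $ i *s e i"

definition act :: "'i list \<Rightarrow> int ^ 'i \<Rightarrow> int ^ 'i" where
  "act ws = foldr (\<lambda>i w. reflect i \<circ> w) ws id"

text \<open>The Weyl-invariant form, scaled so that
  \<open>(\<omega>\<^sub>i, \<alpha>\<^sub>j)\<close> is \<open>d i\<close> for \<open>i = j\<close>
  and 0 otherwise.\<close>

definition pairing :: "int ^ 'i \<Rightarrow> int ^ 'i \<Rightarrow> real" where
  "pairing \<gamma> x = (\<Sum>i\<in>UNIV. d i * of_int (\<gamma> $ i) * of_int (x $ i))"

definition qnorm :: "int ^ 'i \<Rightarrow> real" where
  "qnorm x = pairing (A *v x) x"

text \<open>Since \<open>(\<alpha>\<^sub>j, \<alpha>\<^sub>j) = 2 d\<^sub>j\<close>, the condition says that the coroot \<open>2 x / (x, x)\<close> is an integer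
  combination of the simple coroots.  Unlike membership in a Weyl orbit of simple roots, it
  can be checked one coefficient at a time.\<close>

definition is_root :: "int ^ 'i \<Rightarrow> bool" where
  "is_root x \<longleftrightarrow> x \<noteq> 0 \<and> (\<forall>j. 2 * d j * of_int (x $ j) / qnorm x \<in> \<int>)"

section \<open>Linear algebra of the invariant form and of the two Weyl group actions\<close>

lemma diag: "A $ i $ i = 2"
  using cartan unfolding cartan_matrix_def by simp

lemma off_diag: "i \<noteq> j \<Longrightarrow> A $ i $ j \<le> 0"
  using cartan unfolding cartan_matrix_def by simp

lemma zero_sym: "A $ i $ j = 0 \<longleftrightarrow> A $ j $ i = 0"
  using cartan unfolding cartan_matrix_def by metis

lemma e_nth: "e i $ j = (if j = i then 1 else 0)"
  by (simp add: axis_def)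

lemma A_e: "A *v e j = simple_root A j"
  by (simp add: vec_eq_iff simple_root_nth matrix_vector_mult_def axis_def if_distrib cong: if_cong)

lemma A_e_nth: "(A *v e j) $ i = A $ i $ j"
  by (simp add: A_e simple_root_nth)

lemma A_zero: "A *v 0 = 0"
  by (simp add: vec_eq_iff matrix_vector_mult_def)

lemma A_minus: "A *v (- x) = - (A *v x)"
  by (simp add: vec_eq_iff matrix_vector_mult_def sum_negf)

lemma A_scale: "A *v (k *s x) = k *s (A *v x)"
  by (simp add: vec_eq_iff matrix_vector_mult_def sum_distrib_left algebra_simps)

lemma pairing_diff_left: "pairing (\<gamma> - \<delta>) x = pairing \<gamma> x - pairing \<delta> x"
  and pairing_diff_right: "pairing \<gamma> (x - y) = pairing \<gamma> x - pairing \<gamma> y"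
  and pairing_scale_left: "pairing (k *s \<gamma>) x = of_int k * pairing \<gamma> x"
  and pairing_scale_right: "pairing \<gamma> (k *s x) = of_int k * pairing \<gamma> x"
  and pairing_minus_left: "pairing (- \<gamma>) x = - pairing \<gamma> x"
  and pairing_minus_right: "pairing \<gamma> (- x) = - pairing \<gamma> x"
  unfolding pairing_def
  by (simp_all add: algebra_simps sum.distrib sum_subtractf sum_distrib_left sum_negf)

lemma pairing_e_right: "pairing \<gamma> (e i) = d i * of_int (\<gamma> $ i)"
  and pairing_e_left: "pairing (e i) x = d i * of_int (x $ i)"
  unfolding pairing_def by (simp_all add: axis_def if_distrib if_distribR cong: if_cong)

lemma pairing_A: "pairing (A *v x) y = (\<Sum>i\<in>UNIV. \<Sum>j\<in>UNIV. d i * of_int (A $ i $ j) * of_int (x $ j) * of_int (y $ i))"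
  unfolding pairing_def matrix_vector_mult_def
  by (simp add: sum_distrib_left sum_distrib_right algebra_simps)

lemma pairing_A_commute: "pairing (A *v x) y = pairing (A *v y) x"
proof -
  have "pairing (A *v x) y = (\<Sum>j\<in>UNIV. \<Sum>i\<in>UNIV. d i * of_int (A $ i $ j) * of_int (x $ j) * of_int (y $ i))"
    unfolding pairing_A by (rule sum.swap)
  also have "\<dots> = pairing (A *v y) x"
    unfolding pairing_A by (simp add: symmetrizer algebra_simps)
  finally show ?thesis .
qed

lemma qnorm_pos: "x \<noteq> 0 \<Longrightarrow> qnorm x > 0"
proof -
  assume "x \<noteq> 0"
  then have "(\<chi> i. real_of_int (x $ i)) \<noteq> 0" by (simp add: vec_eq_iff)
  from pos_def[OF this] show ?thesis
    unfolding qnorm_def pairing_A by (simp add: algebra_simps)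
qed

text \<open>A kernel vector has norm 0. Identities of root coordinate vectors can thus be checked on
  weights.\<close>

lemma A_inj: "A *v x = A *v y \<Longrightarrow> x = y"
proof (rule ccontr)
  assume "A *v x = A *v y" "x \<noteq> y"
  then have "qnorm (x - y) = 0" "qnorm (x - y) > 0"
    using qnorm_pos[of "x - y"] by (simp_all add: qnorm_def matrix_vector_mult_diff_distrib pairing_def)
  then show False by simp
qed

lemma qnorm_e: "qnorm (e i) = 2 * d i"
  by (simp add: qnorm_def pairing_e_right A_e_nth diag)

lemma reflect_nth: "reflect i x $ j = (if j = i then x $ i - (A *v x) $ i else x $ j)"
  by (simp add: reflect_def axis_def)

lemma A_reflect: "A *v reflect i x = simple_reflection A i (A *v x)"
  unfolding reflect_def simple_reflection_def matrix_vector_mult_diff_distrib A_scale A_e ..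

lemma reflect_twice: "reflect i (reflect i x) = x"
  by (simp add: reflect_def vec_eq_iff matrix_vector_mult_diff_distrib A_scale A_e_nth diag)

lemma simple_reflection_twice: "simple_reflection A i (simple_reflection A i \<gamma>) = \<gamma>"
  by (simp add: simple_reflection_def vec_eq_iff simple_root_nth diag)

lemma pairing_reflect: "pairing (simple_reflection A i \<gamma>) (reflect i x) = pairing \<gamma> x"
proof -
  have 1: "pairing (A *v e i) x = d i * of_int ((A *v x) $ i)"
    by (simp add: pairing_A_commute[of "e i"] pairing_e_right)
  have "pairing (A *v e i) (e i) = 2 * d i"
    by (simp add: pairing_e_right A_e_nth diag)
  then show ?thesis
    unfolding simple_reflection_def reflect_def A_e[symmetric]
    by (simp add: pairing_diff_left pairing_diff_right pairing_scale_left pairing_scale_right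
        pairing_e_right 1 algebra_simps A_e_nth diag)
qed

lemma qnorm_reflect: "qnorm (reflect i x) = qnorm x"
  by (simp add: qnorm_def A_reflect pairing_reflect)

lemma act_Nil [simp]: "act [] x = x"
  and act_Cons [simp]: "act (i # ws) x = reflect i (act ws x)"
  by (simp_all add: act_def)

lemma act_append: "act (us @ ws) x = act us (act ws x)"
  by (induction us) auto

lemma word_Nil [simp]: "word_elt A [] \<gamma> = \<gamma>"
  and word_Cons [simp]: "word_elt A (i # ws) \<gamma> = simple_reflection A i (word_elt A ws \<gamma>)"
  by (simp_all add: word_elt_def)

lemma word_append: "word_elt A (us @ ws) \<gamma> = word_elt A us (word_elt A ws \<gamma>)"
  by (induction us) auto

lemma A_act: "A *v act ws x = word_elt A ws (A *v x)"
  by (induction ws) (auto simp: A_reflect)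

lemma pairing_act: "pairing (word_elt A ws \<gamma>) (act ws x) = pairing \<gamma> x"
  by (induction ws) (auto simp: pairing_reflect)

lemma qnorm_act: "qnorm (act ws x) = qnorm x"
  by (simp add: qnorm_def A_act pairing_act)

lemma act_rev: "act (rev ws) (act ws x) = x" "act ws (act (rev ws) x) = x"
  by (induction ws arbitrary: x) (auto simp: act_append reflect_twice)

lemma word_rev: "word_elt A (rev ws) (word_elt A ws \<gamma>) = \<gamma>" "word_elt A ws (word_elt A (rev ws) \<gamma>) = \<gamma>"
  by (induction ws arbitrary: \<gamma>) (auto simp: word_append simple_reflection_twice)

lemma reflect_diff: "reflect i (x - y) = reflect i x - reflect i y"
  by (simp add: vec_eq_iff reflect_nth matrix_vector_mult_diff_distrib)

lemma reflect_scale: "reflect i (k *s x) = k *s reflect i x"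
  by (simp add: vec_eq_iff reflect_nth A_scale right_diff_distrib)

lemma simple_reflection_diff:
  "simple_reflection A i (x - y) = simple_reflection A i x - simple_reflection A i y"
  by (simp add: simple_reflection_def vec_eq_iff left_diff_distrib)

lemma simple_reflection_scale: "simple_reflection A i (k *s x) = k *s simple_reflection A i x"
  by (simp add: simple_reflection_def vec_eq_iff right_diff_distrib)

lemma act_diff: "act ws (x - y) = act ws x - act ws y"
  by (induction ws) (simp_all add: reflect_diff)

lemma act_scale: "act ws (k *s x) = k *s act ws x"
  by (induction ws) (simp_all add: reflect_scale)

lemma act_zero: "act ws 0 = 0"
  using act_diff[of ws 0 0] by simp

lemma act_minus: "act ws (- x) = - act ws x"
  using act_diff[of ws 0 x] by (simp add: act_zero)

lemma act_add: "act ws (x + y) = act ws x + act ws y"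
  using act_diff[of ws x "- y"] by (simp add: act_minus)

lemma act_sum: "act ws (\<Sum>i\<in>S. f i) = (\<Sum>i\<in>S. act ws (f i))"
  by (induction S rule: infinite_finite_induct) (auto simp: act_zero act_add)

lemma act_expand: "act ws x = (\<Sum>i\<in>UNIV. x $ i *s act ws (e i))"
  by (subst basis_expansion[of x, symmetric]) (simp add: act_sum act_scale)

lemma word_diff: "word_elt A ws (x - y) = word_elt A ws x - word_elt A ws y"
  by (induction ws) (simp_all add: simple_reflection_diff)

lemma word_scale: "word_elt A ws (k *s x) = k *s word_elt A ws x"
  by (induction ws) (simp_all add: simple_reflection_scale)

lemma word_zero: "word_elt A ws 0 = 0"
  using word_diff[of ws 0 0] by simp

lemma word_minus: "word_elt A ws (- x) = - word_elt A ws x"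
  using word_diff[of ws 0 x] by (simp add: word_zero)

lemma word_add: "word_elt A ws (x + y) = word_elt A ws x + word_elt A ws y"
  using word_diff[of ws x "- y"] by (simp add: word_minus)

lemma word_sum: "word_elt A ws (\<Sum>i\<in>S. f i) = (\<Sum>i\<in>S. word_elt A ws (f i))"
  by (induction S rule: infinite_finite_induct) (auto simp: word_zero word_add)

lemma word_expand: "word_elt A ws x = (\<Sum>i\<in>UNIV. x $ i *s word_elt A ws (e i))"
  by (subst basis_expansion[of x, symmetric]) (simp add: word_sum word_scale)

section \<open>Integrality, signs and finiteness of roots\<close>

lemma root_e: "is_root (e i)"
proof -
  have "2 * d j * of_int (e i $ j) / qnorm (e i) \<in> \<int>" for j
    using d_pos[of i] by (cases "j = i") (simp_all add: qnorm_e e_nth)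
  then show ?thesis by (auto simp: is_root_def)
qed

text \<open>Only the coroot coefficient at \<open>i\<close> changes, and by an integer: the
  symmetrizer rewrites the change as an integer combination of the coroot coefficients of
  \<open>x\<close>.\<close>

lemma is_root_reflect:
  assumes "is_root x"
  shows "is_root (reflect i x)"
proof -
  have *: "2 * d j * of_int (x $ j) / qnorm x \<in> \<int>" for j
    using assms by (simp add: is_root_def)
  have "2 * d i * of_int ((A *v x) $ i) / qnorm x =
      (\<Sum>k\<in>UNIV. of_int (A $ k $ i) * (2 * d k * of_int (x $ k) / qnorm x))"
    unfolding matrix_vector_mult_def
    by (simp add: sum_distrib_left sum_divide_distrib)
      (rule sum.cong, auto simp: symmetrizer[of i] algebra_simps)
  also have "\<dots> \<in> \<int>" by (intro Ints_sum Ints_mult Ints_of_int *)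
  finally have A: "2 * d i * of_int ((A *v x) $ i) / qnorm x \<in> \<int>" .
  have "2 * d j * of_int (reflect i x $ j) / qnorm x \<in> \<int>" for j
  proof (cases "j = i")
    case True
    have "2 * d j * of_int (reflect i x $ j) / qnorm x =
      2 * d i * of_int (x $ i) / qnorm x - 2 * d i * of_int ((A *v x) $ i) / qnorm x"
      using True by (simp add: reflect_nth algebra_simps diff_divide_distrib)
    then show ?thesis using Ints_diff[OF *[of i] A] by simp
  qed (simp add: reflect_nth *)
  moreover have "reflect i x \<noteq> 0"
    using assms reflect_twice[of i x] by (auto simp: is_root_def reflect_def A_zero)
  ultimately show ?thesis by (simp add: is_root_def qnorm_reflect)
qed

lemma root_act: "is_root x \<Longrightarrow> is_root (act ws x)"
  by (induction ws) (auto intro: is_root_reflect)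

text \<open>Since \<open>2 d\<^sub>j p\<^sub>j / qnorm x\<close> is an integer, \<open>2 qnorm p / qnorm x\<close> is the value of a symmetric
  integer double sum with even diagonal, hence even.\<close>

lemma qnorm_part_ge:
  assumes "is_root x" and "p \<noteq> 0" and "\<And>j. p $ j = x $ j \<or> p $ j = 0 \<or> p $ j = - x $ j"
  shows "qnorm p \<ge> qnorm x"
proof -
  have N: "qnorm x > 0" using assms(1) qnorm_pos by (auto simp: is_root_def)
  have "\<exists>u. 2 * d j * of_int (p $ j) / qnorm x = of_int u" for j
  proof -
    obtain u where "2 * d j * of_int (x $ j) / qnorm x = of_int u"
      using assms(1) unfolding is_root_def by (meson Ints_cases)
    with assms(3)[of j] show ?thesis
      by (elim disjE) (force, force, simp, metis of_int_minus)
  qed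
  then obtain u where u: "\<And>j. 2 * d j * of_int (p $ j) / qnorm x = of_int (u j)" by metis
  define t where "t i j = u i * A $ i $ j * p $ j" for i j
  have t: "of_int (t i j) = 2 * (d i * of_int (A $ i $ j)) * of_int (p $ i) * of_int (p $ j) / qnorm x" for i j
    unfolding t_def of_int_mult u[symmetric] by (simp add: algebra_simps)
  have "real_of_int (t i j) = of_int (t j i)" for i j
    unfolding t symmetrizer[of i j] by (simp add: algebra_simps)
  then have t_sym: "t i j = t j i" for i j by (simp only: of_int_eq_iff)
  have "even (\<Sum>i\<in>UNIV. \<Sum>j\<in>UNIV. t i j)"
    by (intro even_symmetric_double_sum t_sym) (simp_all add: t_def diag)
  then obtain k where k: "(\<Sum>i\<in>UNIV. \<Sum>j\<in>UNIV. t i j) = 2 * k" by (auto elim: evenE)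
  have "of_int (\<Sum>i\<in>UNIV. \<Sum>j\<in>UNIV. t i j) = 2 * qnorm p / qnorm x"
    unfolding qnorm_def[of p] pairing_A of_int_sum t
    by (simp add: sum_distrib_left sum_divide_distrib algebra_simps)
  then have "real_of_int k = qnorm p / qnorm x" unfolding k by simp
  moreover from this have "real_of_int k > 0" using N qnorm_pos[OF assms(2)] by simp
  then have "1 * qnorm x \<le> real_of_int k * qnorm x" using N by (intro mult_right_mono) simp_all
  ultimately show ?thesis using N by simp
qed

text \<open>Split a vector of mixed sign into positive and negative parts \<open>p\<close> and
  \<open>q\<close>. Their supports are disjoint, so the cross term is nonpositive and
  \<open>qnorm x\<close> is at least \<open>qnorm p + qnorm q\<close>, hence at least
  \<open>2 * qnorm x\<close> by \<open>qnorm_part_ge\<close>, against positivity.\<close>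

lemma root_sign:
  assumes "is_root x"
  shows "0 \<le> x \<or> x \<le> 0"
proof (rule ccontr)
  assume neg: "\<not> (0 \<le> x \<or> x \<le> 0)"
  define p where "p = (\<chi> i. max (x $ i) 0)"
  define q where "q = (\<chi> i. max (- x $ i) 0)"
  have "p \<noteq> 0" "q \<noteq> 0" using neg by (auto simp: p_def q_def less_eq_vec_def vec_eq_iff max_def)
  have "pairing (A *v p) q \<le> 0"
    unfolding pairing_A
  proof (intro sum_nonpos)
    fix i j
    show "d i * of_int (A $ i $ j) * of_int (p $ j) * of_int (q $ i) \<le> 0"
    proof (cases "i = j")
      case False
      have "of_int (p $ j) \<ge> (0::real)" "of_int (q $ i) \<ge> (0::real)"
        by (auto simp: p_def q_def)
      moreover have "d i * real_of_int (A $ i $ j) \<le> 0"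
        using d_pos[of i] off_diag[OF False] by (simp add: mult_le_0_iff)
      ultimately show ?thesis by (meson mult_nonneg_nonneg mult_nonpos_nonneg)
    qed (auto simp: p_def q_def max_def)
  qed
  moreover have "x = p - q" by (auto simp: p_def q_def vec_eq_iff)
  then have "qnorm x = qnorm p + qnorm q - 2 * pairing (A *v p) q"
    by (simp add: qnorm_def matrix_vector_mult_diff_distrib pairing_diff_left pairing_diff_right pairing_A_commute[of q p])
  moreover have "qnorm p \<ge> qnorm x" "qnorm q \<ge> qnorm x"
    using \<open>p \<noteq> 0\<close> \<open>q \<noteq> 0\<close> by (auto intro!: qnorm_part_ge assms(1) split: if_splits simp: p_def q_def max_def)
  moreover have "qnorm x > 0" using assms qnorm_pos by (auto simp: is_root_def)
  ultimately show False by linarith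
qed

text \<open>Reflection alters only coordinate \<open>i\<close>, so all other coordinates vanish and
  \<open>x = k *s e i\<close>. The coroot coefficient at \<open>i\<close> is then
  \<open>1 / k\<close>, and integrality forces \<open>k = 1\<close>.\<close>

lemma root_reflect_neg:
  assumes "is_root x" "0 \<le> x" "reflect i x \<le> 0"
  shows "x = e i"
proof -
  have "x $ j = 0" if "j \<noteq> i" for j
  proof -
    have "x $ j \<ge> 0" "reflect i x $ j \<le> 0" using assms(2,3) by (auto simp: less_eq_vec_def)
    then show ?thesis using that by (simp add: reflect_nth)
  qed
  then have x: "x = x $ i *s e i" by (auto simp: vec_eq_iff axis_def)
  define k where "k = x $ i"
  have "k \<noteq> 0" using assms(1) x by (auto simp: is_root_def k_def)
  with assms(2) have k: "k > 0" by (auto simp: less_eq_vec_def k_def order_less_le)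
  have N: "qnorm x = of_int k * of_int k * (2 * d i)"
    by (subst x) (simp add: qnorm_def A_scale pairing_scale_left pairing_scale_right qnorm_e[unfolded qnorm_def] k_def)
  have "2 * d i * of_int (x $ i) / qnorm x \<in> \<int>" using assms(1) by (simp add: is_root_def)
  moreover have "2 * d i * of_int (x $ i) / qnorm x = 1 / of_int k"
    unfolding N k_def[symmetric] using k d_pos[of i] by (simp add: field_simps)
  ultimately obtain u where "1 / real_of_int k = of_int u" by (metis Ints_cases)
  then have "real_of_int (u * k) = 1" using k by (simp add: field_simps)
  then have "u * k = 1" by linarith
  then have "k = 1" using k by (auto simp: zmult_eq_1_iff)
  then show ?thesis using x by (simp add: k_def)
qed

text \<open>By compactness of the sphere the form dominates a multiple of the squared Euclidean
  norm, while integrality of the coroot bounds it linearly from above; so the coordinates are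
  bounded.\<close>

lemma finite_roots: "finite (Collect is_root)"
proof (cases "sphere (0::real ^ 'i) 1 = {}")
  case False
  define N where "N x = (\<Sum>i\<in>UNIV. \<Sum>j\<in>UNIV. d i * of_int (A $ i $ j) * x $ i * x $ j)" for x :: "real ^ 'i"
  have "continuous_on (sphere 0 1) N" unfolding N_def by (intro continuous_intros)
  then obtain s where s: "s \<in> sphere 0 1" "\<And>x. x \<in> sphere 0 1 \<Longrightarrow> N s \<le> N x"
    using continuous_attains_inf[OF compact_sphere False] by metis
  have "N s > 0" unfolding N_def using s(1) by (intro pos_def) auto
  have N_scale: "N (k *\<^sub>R x) = k\<^sup>2 * N x" for k x
    unfolding N_def by (simp add: sum_distrib_left power2_eq_square algebra_simps)
  have N_ge: "N x \<ge> N s * (norm x)\<^sup>2" for x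
  proof (cases "x = 0")
    case False
    then have "N s \<le> N ((1 / norm x) *\<^sub>R x)" by (intro s(2)) simp
    then show ?thesis using False by (simp add: N_scale field_simps)
  qed (simp add: N_def)
  define D where "D = Max (range d)"
  have D: "d i \<le> D" for i unfolding D_def by simp
  define K where "K = \<lceil>2 * D / N s\<rceil>"
  have "\<bar>x $ i\<bar> \<le> K" if x: "is_root x" for x i
  proof -
    define X where "X = (\<chi> i. real_of_int (x $ i))"
    \<comment> \<open>A coordinate \<open>j\<close> of largest absolute value is nonzero, so its
      integral coroot coefficient has absolute value at least 1. Bounding this coordinate bounds all
      others.\<close>
    have "Max (range (\<lambda>i. \<bar>x $ i\<bar>)) \<in> range (\<lambda>i. \<bar>x $ i\<bar>)" by (rule Max_in) auto
    then obtain j where j: "\<bar>x $ j\<bar> = Max (range (\<lambda>i. \<bar>x $ i\<bar>))" by force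
    have le: "\<bar>x $ k\<bar> \<le> \<bar>x $ j\<bar>" for k unfolding j by simp
    have "x $ j \<noteq> 0"
    proof
      assume "x $ j = 0"
      with le have "x = 0" by (simp add: vec_eq_iff)
      then show False using that by (simp add: is_root_def)
    qed
    have q: "qnorm x = N X" unfolding N_def X_def qnorm_def pairing_A by (simp add: algebra_simps)
    have qpos: "qnorm x > 0" using that qnorm_pos by (simp add: is_root_def)
    obtain u where u: "2 * d j * of_int (x $ j) / qnorm x = of_int u"
      using x unfolding is_root_def by (metis Ints_cases)
    have "u \<noteq> 0" using u \<open>x $ j \<noteq> 0\<close> d_pos[of j] qpos by auto
    then have "1 \<le> \<bar>2 * d j * of_int (x $ j) / qnorm x\<bar>" unfolding u by linarith
    then have "qnorm x \<le> 2 * d j * \<bar>of_int (x $ j)\<bar>"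
      using qpos d_pos[of j] by (simp add: abs_mult field_simps)
    moreover have "N s * \<bar>of_int (x $ j)\<bar>\<^sup>2 \<le> N s * (norm X)\<^sup>2"
      using component_le_norm_cart[of X j] \<open>N s > 0\<close>
      by (intro mult_left_mono power_mono) (auto simp: X_def)
    ultimately have "N s * \<bar>of_int (x $ j)\<bar> * \<bar>of_int (x $ j)\<bar> \<le> 2 * d j * \<bar>of_int (x $ j)\<bar>"
      using N_ge[of X] q by (simp add: power2_eq_square)
    then have "N s * \<bar>of_int (x $ j)\<bar> \<le> 2 * d j" using \<open>x $ j \<noteq> 0\<close> by simp
    also have "\<dots> \<le> 2 * D" using D by simp
    finally have "\<bar>real_of_int (x $ j)\<bar> \<le> 2 * D / N s" using \<open>N s > 0\<close> by (simp add: field_simps)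
    then have "\<bar>x $ j\<bar> \<le> K" unfolding K_def by linarith
    then show ?thesis using le[of i] by linarith
  qed
  then have "Collect is_root \<subseteq> {x. \<forall>i. \<bar>x $ i\<bar> \<le> K}" by auto
  then show ?thesis by (rule finite_subset) (rule finite_bounded_int_vec)
qed (metis ex_in_conv vector_choose_size mem_sphere_0 zero_le_one)

lemma not_nonpos_e: "\<not> e i \<le> 0"
  by (auto simp: less_eq_vec_def e_nth intro!: exI[of _ i])

lemma word_simple_root: "word_elt A ws (simple_root A i) = A *v act ws (e i)"
  by (simp add: A_act A_e)

text \<open>An element is determined by its images of the simple roots, and these lie in a finite
  set.\<close>

lemma weyl_finite: "finite (weyl_group A)"
proof -
  define f where "f w = (\<lambda>i. w (simple_root A i))" for w :: "int ^ 'i \<Rightarrow> int ^ 'i"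
  have "word_elt A ws (simple_root A i) \<in> (*v) A ` Collect is_root" for ws i
    unfolding word_simple_root by (rule imageI) (simp add: root_act root_e)
  then have "f ` weyl_group A \<subseteq> UNIV \<rightarrow>\<^sub>E ((*v) A ` Collect is_root)"
    unfolding f_def weyl_group_def by auto
  moreover have "finite \<dots>" using finite_roots by (intro finite_PiE) auto
  ultimately have fin: "finite (f ` weyl_group A)" by (rule finite_subset)
  have "inj_on f (weyl_group A)"
  proof (rule inj_onI)
    fix v w assume vw: "v \<in> weyl_group A" "w \<in> weyl_group A" "f v = f w"
    then obtain us ws where us: "v = word_elt A us" "w = word_elt A ws"
      by (auto simp: weyl_group_def)
    have "A *v act us (e i) = A *v act ws (e i)" for i
      using fun_cong[OF vw(3), of i] by (simp add: f_def us word_simple_root)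
    then have act: "act us x = act ws x" for x
      by (subst (1 2) act_expand) (metis A_inj)
    have "word_elt A us \<gamma> $ i = word_elt A ws \<gamma> $ i" for \<gamma> i
    proof -
      \<comment> \<open>Agreement on roots passes to weights by invariance: \<open>x\<close> is sent
        to \<open>e i\<close> by both words, so \<open>pairing \<gamma> x\<close> reads off
        coordinate \<open>i\<close> of both images of \<open>\<gamma>\<close>.\<close>
      define x where "x = act (rev us) (e i)"
      have x: "act us x = e i" "act ws x = e i" by (simp_all add: x_def act_rev act[symmetric])
      have "d i * of_int (word_elt A us \<gamma> $ i) = pairing \<gamma> x"
        using pairing_act[of us \<gamma> x] by (simp add: x pairing_e_right)
      also have "\<dots> = d i * of_int (word_elt A ws \<gamma> $ i)"
        using pairing_act[of ws \<gamma> x] by (simp add: x pairing_e_right)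
      finally show ?thesis using d_pos[of i] by simp
    qed
    then show "v = w" by (auto simp: us vec_eq_iff)
  qed
  with fin show ?thesis by (rule finite_imageD)
qed

section \<open>The longest element\<close>

text \<open>If \<open>w\<close> sends \<open>\<alpha>\<^sub>i\<close> to
  \<open>\<alpha>\<^sub>t\<close>, it conjugates \<open>s\<^sub>i\<close> to
  \<open>s\<^sub>t\<close>. Invariance of the norm gives \<open>d t = d i\<close>, which matches the
  two coordinates.\<close>

lemma reflection_conjugate:
  assumes "act ws (e i) = e t"
  shows "word_elt A (ws @ [i]) = word_elt A (t # ws)"
proof
  fix \<gamma>
  have "d t = d i" using qnorm_act[of ws "e i"] by (simp add: assms qnorm_e)
  moreover have "d t * of_int (word_elt A ws \<gamma> $ t) = d i * of_int (\<gamma> $ i)"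
    using pairing_act[of ws \<gamma> "e i"] by (simp add: assms pairing_e_right)
  ultimately have "word_elt A ws \<gamma> $ t = \<gamma> $ i" using d_pos[of i] by simp
  then show "word_elt A (ws @ [i]) \<gamma> = word_elt A (t # ws) \<gamma>"
    using word_simple_root[of ws i] by (simp add: word_append simple_reflection_def[of A i]
        simple_reflection_def[of A t] word_diff word_scale assms A_e)
qed

text \<open>Some letter \<open>t\<close> first turns the image of \<open>\<alpha>\<^sub>i\<close>
  negative, and there the image is \<open>\<alpha>\<^sub>t\<close>. By
  \<open>reflection_conjugate\<close> that letter cancels against the appended
  \<open>i\<close>.\<close>

lemma exchange:
  assumes "act ws (e i) \<le> 0"
  shows "\<exists>vs. word_elt A vs = word_elt A (ws @ [i]) \<and> Suc (length vs) = length ws"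
  using assms
proof (induction ws)
  case (Cons t ws)
  show ?case
  proof (cases "act ws (e i) \<le> 0")
    case True
    then obtain vs where "word_elt A vs = word_elt A (ws @ [i])" "Suc (length vs) = length ws"
      using Cons.IH by blast
    then show ?thesis by (intro exI[of _ "t # vs"]) (auto simp: fun_eq_iff)
  next
    case False
    then have "act ws (e i) = e t"
      using Cons.prems root_act[OF root_e, of ws i] root_sign by (intro root_reflect_neg) auto
    then have "word_elt A (t # ws @ [i]) = word_elt A ws"
      using reflection_conjugate by (auto simp: fun_eq_iff simple_reflection_twice)
    then show ?thesis by (intro exI[of _ ws]) auto
  qed
qed (simp add: not_nonpos_e)

text \<open>Split off the last letter \<open>i\<close>. If the rest \<open>us\<close> keeps
  \<open>\<alpha>\<^sub>i\<close> positive, the difference grows by a nonnegative multiple of that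
  image; otherwise \<open>exchange\<close> gives a word shorter by two letters.\<close>

lemma dominant_minus_word:
  assumes "0 \<le> \<gamma>"
  shows "\<exists>x\<ge>0. \<gamma> - word_elt A ws \<gamma> = A *v x"
proof (induction "length ws" arbitrary: ws rule: less_induct)
  case less
  show ?case
  proof (cases ws rule: rev_cases)
    case Nil
    then show ?thesis by (intro exI[of _ 0]) (simp add: A_zero)
  next
    case (snoc us i)
    show ?thesis
    proof (cases "act us (e i) \<le> 0")
      case True
      from exchange[OF this] obtain vs
        where "word_elt A vs = word_elt A ws" "Suc (length vs) = length us" using snoc by auto
      then show ?thesis using less[of vs] snoc by auto
    next
      case False
      then have "0 \<le> act us (e i)" using root_sign root_act root_e by blast
      moreover obtain x where x: "0 \<le> x" "\<gamma> - word_elt A us \<gamma> = A *v x"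
        using less[of us] snoc by auto
      moreover have "\<gamma> $ i \<ge> 0" using assms by (simp add: less_eq_vec_def)
      ultimately have "0 \<le> x + \<gamma> $ i *s act us (e i)" by (simp add: less_eq_vec_def)
      moreover have "\<gamma> - word_elt A ws \<gamma> = A *v (x + \<gamma> $ i *s act us (e i))"
        using x(2) by (simp add: snoc word_append simple_reflection_def word_diff word_scale
            word_simple_root matrix_vector_right_distrib A_scale algebra_simps)
      ultimately show ?thesis by blast
    qed
  qed
qed

lemma dominant_unique:
  assumes "0 \<le> \<gamma>" "0 \<le> word_elt A ws \<gamma>"
  shows "word_elt A ws \<gamma> = \<gamma>"
proof -
  obtain x where x: "0 \<le> x" "\<gamma> - word_elt A ws \<gamma> = A *v x"
    using dominant_minus_word[OF assms(1)] by blast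
  obtain y where y: "0 \<le> y" "word_elt A ws \<gamma> - \<gamma> = A *v y"
    using dominant_minus_word[OF assms(2), of "rev ws"] by (auto simp: word_rev)
  have "A *v (x + y) = A *v 0"
    by (simp add: matrix_vector_right_distrib A_zero flip: x(2) y(2))
  then have "x + y = 0" by (rule A_inj)
  then have "x = 0" using x(1) y(1)
    by (simp add: less_eq_vec_def vec_eq_iff) (metis add_nonneg_eq_0_iff)
  then show ?thesis using x(2) by (simp add: A_zero)
qed

lemma weyl_length_le: "weyl_length A (word_elt A ws) \<le> length ws"
  unfolding weyl_length_def by (rule Least_le) blast

lemma reduced_word:
  obtains vs where "word_elt A vs = word_elt A ws" "length vs = weyl_length A (word_elt A ws)"
proof -
  have "\<exists>vs. length vs = weyl_length A (word_elt A ws) \<and> word_elt A vs = word_elt A ws"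
    unfolding weyl_length_def by (rule LeastI[of _ "length ws"]) blast
  then show ?thesis using that by blast
qed

text \<open>If \<open>w\<close> kept \<open>\<alpha>\<^sub>i\<close> positive, a shortest word for
  \<open>w s\<^sub>i\<close> would make it negative. Then \<open>exchange\<close> yields a still
  shorter word for \<open>w\<close>, so \<open>w s\<^sub>i\<close> is longer than
  \<open>w\<close>.\<close>

lemma maximal_length_neg:
  assumes "\<And>us. weyl_length A (word_elt A us) \<le> weyl_length A (word_elt A ws)"
  shows "act ws (e i) \<le> 0"
proof (rule ccontr)
  assume "\<not> act ws (e i) \<le> 0"
  then have pos: "0 \<le> act ws (e i)" using root_sign root_act root_e by blast
  obtain us where us: "word_elt A us = word_elt A (ws @ [i])"
    "length us = weyl_length A (word_elt A (ws @ [i]))" by (rule reduced_word)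
  have "act us (e i) = act (ws @ [i]) (e i)" by (rule A_inj) (simp add: A_act us(1))
  also have "\<dots> = - act ws (e i)"
  proof -
    have "reflect i (e i) = - e i" by (simp add: reflect_def A_e_nth diag vec_eq_iff e_nth)
    then show ?thesis by (simp add: act_append act_minus)
  qed
  finally have "act us (e i) \<le> 0" using pos by (simp add: less_eq_vec_def)
  then obtain vs where vs: "word_elt A vs = word_elt A (us @ [i])" "Suc (length vs) = length us"
    using exchange by blast
  have "word_elt A vs = word_elt A ws"
    by (simp add: fun_eq_iff vs(1) word_append us(1) simple_reflection_twice)
  then have "weyl_length A (word_elt A ws) < weyl_length A (word_elt A (ws @ [i]))"
    using weyl_length_le[of vs] vs(2) us(2) by simp
  then show False using assms[of "ws @ [i]"] by simp
qed

text \<open>Coordinate \<open>i\<close> of the image has the sign of the pairing of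
  \<open>\<gamma>\<close> with the preimage \<open>y\<close> of \<open>\<alpha>\<^sub>i\<close>. A
  positive \<open>y\<close> would have a nonpositive image, so \<open>y\<close> is negative.\<close>

lemma word_antidominant:
  assumes "\<And>i. act ws (e i) \<le> 0" "0 \<le> \<gamma>"
  shows "0 \<le> - word_elt A ws \<gamma>"
proof -
  have "word_elt A ws \<gamma> $ i \<le> 0" for i
  proof -
    define y where "y = act (rev ws) (e i)"
    have y: "act ws y = e i" by (simp add: y_def act_rev)
    have "\<not> 0 \<le> y"
    proof
      assume "0 \<le> y"
      have "act ws y \<le> 0"
        unfolding act_expand[of ws y] using assms(1) \<open>0 \<le> y\<close>
        by (simp add: less_eq_vec_def sum_nonpos mult_nonneg_nonpos)
      then show False using y not_nonpos_e by simp
    qed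
    then have "y \<le> 0" using root_sign[of y] root_act root_e unfolding y_def by blast
    then have "pairing \<gamma> y \<le> 0"
      unfolding pairing_def using assms(2) d_pos
      by (intro sum_nonpos mult_nonneg_nonpos) (auto simp: less_eq_vec_def less_imp_le)
    moreover have "pairing \<gamma> y = d i * of_int (word_elt A ws \<gamma> $ i)"
      using pairing_act[of ws \<gamma> y] by (simp add: y pairing_e_right)
    ultimately show ?thesis using d_pos[of i] by (simp add: mult_le_0_iff)
  qed
  then show ?thesis by (simp add: less_eq_vec_def)
qed

lemma antidominant_unique:
  assumes "0 \<le> - word_elt A us \<gamma>" "0 \<le> - word_elt A ws \<gamma>"
  shows "word_elt A us \<gamma> = word_elt A ws \<gamma>"
  using dominant_unique[OF assms(1), of "ws @ rev us"] assms(2)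
  by (simp add: word_append word_minus word_rev)

lemma e_dominant: "0 \<le> e i"
  by (simp add: less_eq_vec_def e_nth)

text \<open>The definite description needs uniqueness: two elements of maximal length send each
  \<open>\<omega>\<^sub>i\<close> to the same antidominant weight, hence agree by linearity.\<close>

lemma longest_word:
  obtains ws where "longest_elt A = word_elt A ws" "\<And>i. act ws (e i) \<le> 0"
proof -
  let ?P = "\<lambda>w. w \<in> weyl_group A \<and> (\<forall>v\<in>weyl_group A. weyl_length A v \<le> weyl_length A w)"
  have "Max (weyl_length A ` weyl_group A) \<in> weyl_length A ` weyl_group A"
    by (intro Max_in finite_imageI weyl_finite) (simp add: weyl_group_def)
  then obtain w where "w \<in> weyl_group A" "weyl_length A w = Max (weyl_length A ` weyl_group A)"
    by fastforce
  then have w: "?P w" by (simp add: weyl_finite)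
  have neg: "act ws (e i) \<le> 0" if "?P (word_elt A ws)" for ws i
    using that by (intro maximal_length_neg) (auto simp: weyl_group_def)
  have "longest_elt A = w" unfolding longest_elt_def
  proof (rule the_equality)
    fix v assume v: "?P v"
    obtain us ws where us: "v = word_elt A us" "w = word_elt A ws"
      using v w by (auto simp: weyl_group_def)
    have "v (e i) = w (e i)" for i
      unfolding us using neg v w
      by (intro antidominant_unique word_antidominant e_dominant) (auto simp: us)
    then have "v \<gamma> = w \<gamma>" for \<gamma>
      unfolding us by (subst (1 2) word_expand) simp
    then show "v = w" by (rule ext)
  qed (rule w)
  moreover obtain ws where "w = word_elt A ws" using w by (auto simp: weyl_group_def)
  ultimately show ?thesis using neg w that by metis
qed

section \<open>Coxeter elements\<close>

lemma act_nth_notin: "l \<notin> set us \<Longrightarrow> act us x $ l = x $ l"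
  by (induction us) (auto simp: reflect_nth)

lemma word_e_notin: "k \<notin> set us \<Longrightarrow> word_elt A us (e k) = e k"
  by (induction us) (auto simp: simple_reflection_def e_nth)

lemma reflect_e: "reflect i (e i) = - e i"
  by (simp add: reflect_def A_e_nth diag vec_eq_iff e_nth)

lemma root_nonneg: "is_root x \<Longrightarrow> 0 < x $ k \<Longrightarrow> 0 \<le> x"
  using root_sign[of x] by (auto simp: less_eq_vec_def) (meson leD)

lemma root_nonpos: "is_root x \<Longrightarrow> x $ k < 0 \<Longrightarrow> x \<le> 0"
  using root_sign[of x] by (auto simp: less_eq_vec_def) (meson leD)

text \<open>Stop at the last letter \<open>t\<close> that turns the sign. By
  \<open>root_reflect_neg\<close> the vector there is \<open>e t\<close>; the letters
  \<open>us1\<close> still have to act on its negative.\<close>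

lemma root_becoming_negative:
  assumes "is_root x" "0 \<le> x" "act us x \<le> 0"
  shows "\<exists>us1 t us2. us = us1 @ t # us2 \<and> act us x = - act us1 (e t)"
  using assms(3)
proof (induction us)
  case Nil
  then have "x = 0" using assms(2) by (simp add: order_antisym)
  then show ?case using assms(1) by (simp add: is_root_def)
next
  case (Cons s us)
  show ?case
  proof (cases "act us x \<le> 0")
    case True
    then obtain us1 t us2 where *: "us = us1 @ t # us2" "act us x = - act us1 (e t)"
      using Cons.IH by blast
    have "act (s # us) x = - act (s # us1) (e t)"
      using act_minus[of "[s]"] by (simp add: *(2))
    then show ?thesis using *(1) by (intro exI[of _ "s # us1"] exI[of _ t] exI[of _ us2]) auto
  next
    case False
    then have "act us x = e s"
      using Cons.prems root_sign[of "act us x"] root_act[OF assms(1)]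
      by (intro root_reflect_neg) auto
    then show ?thesis by (intro exI[of _ "[]"] exI[of _ s] exI[of _ us]) (auto simp: reflect_e)
  qed
qed

lemma word_support: "\<exists>x. (\<forall>l. l \<notin> set us \<longrightarrow> x $ l = 0) \<and> word_elt A us \<gamma> = \<gamma> + A *v x"
proof (induction us)
  case Nil
  show ?case by (intro exI[of _ 0]) (simp add: A_zero)
next
  case (Cons i us)
  then obtain x where x: "\<forall>l. l \<notin> set us \<longrightarrow> x $ l = 0" "word_elt A us \<gamma> = \<gamma> + A *v x" by blast
  have "word_elt A (i # us) \<gamma> = word_elt A us \<gamma> - word_elt A us \<gamma> $ i *s (A *v e i)"
    by (simp add: simple_reflection_def A_e)
  also have "\<dots> = \<gamma> + A *v (x - word_elt A us \<gamma> $ i *s e i)"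
    unfolding matrix_vector_mult_diff_distrib A_scale by (subst x(2)) simp
  finally have "word_elt A (i # us) \<gamma> = \<gamma> + A *v (x - word_elt A us \<gamma> $ i *s e i)" .
  then show ?case using x(1)
    by (intro exI[of _ "x - word_elt A us \<gamma> $ i *s e i"]) (auto simp: e_nth)
qed

text \<open>Peel off the first letter \<open>i\<close>. The remaining word moves
  \<open>\<gamma>\<close> within the span of simple roots other than
  \<open>\<alpha>\<^sub>i\<close>, yet by a multiple of \<open>\<alpha>\<^sub>i\<close>; by linear
  independence it moves \<open>\<gamma>\<close> not at all.\<close>

lemma distinct_word_fixed:
  assumes "distinct us" "word_elt A us \<gamma> = \<gamma>" "k \<in> set us"
  shows "\<gamma> $ k = 0"
  using assms
proof (induction us)
  case (Cons i us)
  obtain x where x: "\<forall>l. l \<notin> set us \<longrightarrow> x $ l = 0" "word_elt A us \<gamma> = \<gamma> + A *v x"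
    using word_support by blast
  define m where "m = word_elt A us \<gamma> $ i"
  have "A *v x = A *v (m *s e i)"
    using Cons.prems(2) x(2) by (simp add: simple_reflection_def A_scale A_e m_def algebra_simps)
  then have "x = m *s e i" by (rule A_inj)
  then have "m = 0" using x(1) Cons.prems(1) by (auto simp: e_nth)
  then have fixed: "word_elt A us \<gamma> = \<gamma>" using x(2) \<open>x = m *s e i\<close> by (simp add: A_zero)
  show ?case
  proof (cases "k = i")
    case True
    then show ?thesis using fixed \<open>m = 0\<close> by (simp add: m_def)
  next
    case False
    then show ?thesis using Cons fixed by simp
  qed
qed simp

text \<open>Letters in \<open>vs\<close> preserve the coefficients at \<open>k\<close> and
  \<open>l\<close>. The letter \<open>l\<close> then adds a sum of nonnegative terms whose term at
  \<open>k\<close> is positive, and \<open>us\<close> preserves the result.\<close>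

lemma coeff_pos:
  assumes "is_root z" "0 < z $ k" "z $ l = 0" "A $ l $ k \<noteq> 0"
    and "k \<notin> set vs" "l \<notin> set vs" "l \<notin> set us"
  shows "0 < act (us @ l # vs) z $ l"
proof -
  define y where "y = act vs z"
  have yk: "y $ k = z $ k" and yl: "y $ l = 0"
    using assms by (simp_all add: y_def act_nth_notin)
  have "0 \<le> y" using root_nonneg[of y k] yk assms(1,2) root_act by (simp add: y_def)
  then have y: "y $ j \<ge> 0" for j by (simp add: less_eq_vec_def)
  have "k \<noteq> l" using assms(2,3) by auto
  have nonpos: "A $ l $ j * y $ j \<le> 0" for j
    using yl y[of j] off_diag[of l j] by (cases "j = l") (auto simp: mult_nonpos_nonneg)
  have "(A *v y) $ l = A $ l $ k * y $ k + (\<Sum>j\<in>UNIV - {k}. A $ l $ j * y $ j)"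
    by (simp add: matrix_vector_mult_def sum.remove)
  moreover have "(\<Sum>j\<in>UNIV - {k}. A $ l $ j * y $ j) \<le> 0" by (intro sum_nonpos nonpos)
  moreover have "A $ l $ k * y $ k < 0"
    using assms(2,4) yk off_diag[of l k] \<open>k \<noteq> l\<close> by (intro mult_neg_pos) auto
  ultimately have "(A *v y) $ l < 0" by linarith
  then show ?thesis using assms(7) yl by (simp add: act_append act_nth_notin reflect_nth flip: y_def)
qed

end

section \<open>Orbits of the fundamental weights under a Coxeter element\<close>

locale coxeter = finite_cartan A d
  for A :: "int ^ 'i ^ 'i::finite" and d :: "'i \<Rightarrow> real" +
  fixes ws :: "'i list"
  assumes distinct_ws: "distinct ws" and set_ws: "set ws = UNIV"
begin

text \<open>\<open>beta k\<close> is \<open>\<omega>\<^sub>k - c \<omega>\<^sub>k\<close> in root coordinates, see \<open>A_beta\<close> below.\<close>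

definition before :: "'i \<Rightarrow> 'i list" where
  "before k = takeWhile (\<lambda>l. l \<noteq> k) ws"

definition beta :: "'i \<Rightarrow> int ^ 'i" where
  "beta k = act (before k) (e k)"

definition power_word :: "nat \<Rightarrow> 'i list" where
  "power_word m = concat (replicate m ws)"

text \<open>The first time the orbit of \<open>beta k\<close> turns negative, phrased without
  \<open>star\<close>; \<open>cox_h_eq\<close> identifies it with \<open>cox_h\<close>.\<close>

definition h :: "'i \<Rightarrow> nat" where
  "h k = (LEAST m. act (power_word m) (beta k) \<le> 0)"

lemma before_eq: "ws = us @ k # vs \<Longrightarrow> before k = us"
  using distinct_ws unfolding before_def by (auto simp: takeWhile_append)

lemma ws_split:
  obtains vs where "ws = before k @ k # vs" "k \<notin> set (before k)" "k \<notin> set vs"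
proof -
  have "k \<in> set ws" by (simp add: set_ws)
  then obtain us vs where "ws = us @ k # vs" by (meson split_list)
  then show ?thesis using before_eq[of us k vs] distinct_ws that by auto
qed

lemma before_split:
  assumes "i \<in> set (before j)"
  obtains vs xs where "before j = before i @ i # vs" "ws = before i @ i # vs @ j # xs"
    "i \<notin> set vs" "j \<notin> set (before i)" "j \<notin> set xs" "i \<notin> set xs" "i \<noteq> j" "j \<notin> set vs" "i \<notin> set (before i)"
proof -
  obtain xs where xs: "ws = before j @ j # xs" by (rule ws_split)
  obtain us vs where vs: "before j = us @ i # vs" using assms by (meson split_list)
  have "before i = us" using xs vs by (intro before_eq[of _ _ "vs @ j # xs"]) simp
  then show ?thesis using that[of vs xs] xs vs distinct_ws by auto
qed

lemma before_asym: "i \<in> set (before j) \<Longrightarrow> j \<notin> set (before i)"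
  by (metis before_split)

lemma beta_diag: "beta k $ k = 1"
proof -
  obtain vs where "k \<notin> set (before k)" by (rule ws_split)
  then show ?thesis by (simp add: beta_def act_nth_notin)
qed

lemma beta_nth_zero: "l \<noteq> k \<Longrightarrow> l \<notin> set (before k) \<Longrightarrow> beta k $ l = 0"
  by (simp add: beta_def act_nth_notin e_nth)

lemma root_beta: "is_root (beta k)"
  by (simp add: beta_def root_act root_e)

lemma beta_nonneg: "0 \<le> beta k"
  using root_nonneg[OF root_beta, of k k] by (simp add: beta_diag)

text \<open>Letters after \<open>k\<close> fix \<open>\<omega>\<^sub>k\<close>, the letter
  \<open>k\<close> subtracts \<open>\<alpha>\<^sub>k\<close>, and the letters before
  \<open>k\<close> fix \<open>\<omega>\<^sub>k\<close> again while carrying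
  \<open>\<alpha>\<^sub>k\<close> to \<open>beta k\<close>.\<close>

lemma A_beta: "A *v beta k = e k - word_elt A ws (e k)"
proof -
  obtain vs where "ws = before k @ k # vs" "k \<notin> set vs" by (rule ws_split)
  then have "word_elt A ws (e k) = word_elt A (before k) (simple_reflection A k (e k))"
    by (metis word_append word_Cons word_e_notin)
  also have "\<dots> = word_elt A (before k) (e k) - A *v beta k"
    by (simp add: simple_reflection_def word_diff word_scale word_simple_root beta_def e_nth)
  also obtain vs where "k \<notin> set (before k)" by (rule ws_split)
  then have "word_elt A (before k) (e k) = e k" by (rule word_e_notin)
  finally show ?thesis by simp
qed

lemma word_ws_fixed:
  assumes "word_elt A ws \<gamma> = \<gamma>"
  shows "\<gamma> = 0"
proof -
  have "\<gamma> $ k = 0" for k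
    by (rule distinct_word_fixed[OF distinct_ws assms]) (simp add: set_ws)
  then show ?thesis by (simp add: vec_eq_iff)
qed

lemma power_word_0 [simp]: "power_word 0 = []"
  and power_word_Suc: "power_word (Suc m) = ws @ power_word m"
  by (simp_all add: power_word_def)

lemma power_word_Suc': "power_word (Suc m) = power_word m @ ws"
  by (induction m) (simp_all add: power_word_Suc)

lemma funpow_word: "(word_elt A ws ^^ m) \<gamma> = word_elt A (power_word m) \<gamma>"
  by (induction m) (simp_all add: power_word_Suc word_append)

lemma chain_step:
  "word_elt A (power_word m) (e k) - word_elt A (power_word (Suc m)) (e k) =
    A *v act (power_word m) (beta k)"
  by (simp add: A_act A_beta word_diff power_word_Suc' word_append)

text \<open>Otherwise the weights \<open>c\<^sup>m \<omega>\<^sub>k\<close> would decrease strictly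
  forever, although the powers of \<open>c\<close> repeat in a finite group.\<close>

lemma ex_act_beta_nonpos: "\<exists>m. act (power_word m) (beta k) \<le> 0"
proof (rule ccontr)
  assume "\<nexists>m. act (power_word m) (beta k) \<le> 0"
  then have pos: "0 \<le> act (power_word m) (beta k)" for m
    using root_sign root_act root_beta by blast
  have nz: "act (power_word m) (beta k) \<noteq> 0" for m
    using root_act[OF root_beta] by (auto simp: is_root_def)
  have desc: "\<exists>x\<ge>0. x \<noteq> 0 \<and>
      word_elt A (power_word m) (e k) - word_elt A (power_word (m + Suc n)) (e k) = A *v x" for m n
  proof (induction n)
    case 0
    show ?case using chain_step[of m k] pos[of m] nz[of m] by auto
  next
    case (Suc n)
    then obtain x where x: "0 \<le> x" "x \<noteq> 0"
      "word_elt A (power_word m) (e k) - word_elt A (power_word (m + Suc n)) (e k) = A *v x" by blast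
    let ?y = "act (power_word (m + Suc n)) (beta k)"
    have "word_elt A (power_word m) (e k) - word_elt A (power_word (m + Suc (Suc n))) (e k) =
        A *v (x + ?y)"
      using x(3) chain_step[of "m + Suc n" k] by (simp add: matrix_vector_right_distrib algebra_simps)
    moreover have "0 \<le> x + ?y" using x(1) pos[of "m + Suc n"] by (simp add: less_eq_vec_def)
    moreover have "x + ?y \<noteq> 0"
      using x(1,2) pos[of "m + Suc n"] by (auto simp: less_eq_vec_def vec_eq_iff) (metis add_nonneg_eq_0_iff)
    ultimately show ?case by blast
  qed
  have "finite (range (\<lambda>m. word_elt A (power_word m)))"
    by (rule finite_subset[OF _ weyl_finite]) (auto simp: weyl_group_def)
  then have "\<not> inj (\<lambda>m. word_elt A (power_word m))"
    using finite_imageD[of _ "UNIV :: nat set"] by auto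
  then obtain m n where mn: "m < n" "word_elt A (power_word m) = word_elt A (power_word n)"
    by (metis (no_types, lifting) injI linorder_neqE_nat)
  then obtain l where "n = m + Suc l" by (metis less_iff_Suc_add add_Suc_right)
  then obtain x where "x \<noteq> 0" "A *v x = A *v 0" using desc[of m l] mn(2) by (auto simp: A_zero)
  then show False using A_inj by blast
qed

lemma act_h: "act (power_word (h k)) (beta k) \<le> 0"
  unfolding h_def using ex_act_beta_nonpos by (rule LeastI_ex)

lemma h_le: "act (power_word m) (beta k) \<le> 0 \<Longrightarrow> h k \<le> m"
  unfolding h_def by (rule Least_le)

lemma act_less_h: "m < h k \<Longrightarrow> 0 \<le> act (power_word m) (beta k)"
  using h_le[of m k] root_sign root_act root_beta by (meson leD)

lemma h_pos: "0 < h k"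
proof (rule ccontr)
  assume "\<not> 0 < h k"
  then have "beta k \<le> 0" using act_h[of k] by simp
  then show False using beta_diag[of k] by (metis less_eq_vec_def zero_index not_one_le_zero)
qed

lemma root_made_negative:
  assumes "is_root x" "0 \<le> x" "act ws x \<le> 0"
  shows "\<exists>t. act ws x = - beta t"
  using root_becoming_negative[OF assms] before_eq unfolding beta_def by metis

lemma chain_end: "\<exists>t. word_elt A (power_word (h k)) (e k) = - e t"
proof -
  obtain m where m: "h k = Suc m" using h_pos gr0_implies_Suc by blast
  obtain t where t: "act (power_word (h k)) (beta k) = - beta t"
    using root_made_negative[of "act (power_word m) (beta k)"] act_less_h[of m k] act_h[of k]
    by (auto simp: m power_word_Suc act_append root_act root_beta)
  define \<delta> where "\<delta> = word_elt A (power_word (h k)) (e k) + e t"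
  have "\<delta> - word_elt A ws \<delta> = A *v act (power_word (h k)) (beta k) + A *v beta t"
    unfolding chain_step[symmetric] A_beta
    by (simp add: \<delta>_def word_add power_word_Suc word_append)
  then have "word_elt A ws \<delta> = \<delta>" by (simp add: t A_minus)
  then have "\<delta> = 0" by (rule word_ws_fixed)
  then show ?thesis by (auto simp: \<delta>_def eq_neg_iff_add_eq_0)
qed

text \<open>The longest element and the power \<open>h k\<close> of \<open>c\<close> both send
  \<open>\<omega>\<^sub>k\<close> to an antidominant weight, and its orbit has only one.\<close>

lemma longest_star: "longest_elt A (e k) = - e (star A k)"
  and chain_end_star: "word_elt A (power_word (h k)) (e k) = - e (star A k)"
proof -
  obtain t where t: "word_elt A (power_word (h k)) (e k) = - e t" using chain_end by blast
  obtain us where us: "longest_elt A = word_elt A us" "\<And>i. act us (e i) \<le> 0"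
    using longest_word by blast
  have longest: "longest_elt A (e k) = - e t"
    using antidominant_unique[of us "e k" "power_word (h k)"] word_antidominant[OF us(2) e_dominant]
      e_dominant[of t] by (simp add: us(1) t)
  have "star A k = t"
    unfolding star_def fund_weight_def longest by (rule the_equality) (auto simp: axis_eq_axis)
  then show "longest_elt A (e k) = - e (star A k)"
    "word_elt A (power_word (h k)) (e k) = - e (star A k)" using longest t by auto
qed

lemma act_h_beta: "act (power_word (h k)) (beta k) = - beta (star A k)"
proof (rule A_inj)
  show "A *v act (power_word (h k)) (beta k) = A *v (- beta (star A k))"
    unfolding chain_step[symmetric] A_minus A_beta
    by (simp add: power_word_Suc word_append chain_end_star word_minus)
qed

section \<open>Agreement of \<open>h\<close> with \<open>cox_h\<close>\<close>

lemma weight_ge_iff: "weight_ge A \<gamma> \<delta> \<longleftrightarrow> (\<exists>x\<ge>0. \<gamma> - \<delta> = A *v x)"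
proof -
  have sum: "(\<Sum>i\<in>UNIV. x $ i *s simple_root A i) = A *v x" for x
    by (simp add: vec_eq_iff simple_root_nth matrix_vector_mult_def mult.commute)
  show ?thesis
  proof
    assume "weight_ge A \<gamma> \<delta>"
    then obtain n where "\<gamma> - \<delta> = (\<Sum>i\<in>UNIV. int (n i) *s simple_root A i)"
      by (auto simp: weight_ge_def)
    then show "\<exists>x\<ge>0. \<gamma> - \<delta> = A *v x"
      using sum[of "\<chi> i. int (n i)"] by (intro exI[of _ "\<chi> i. int (n i)"]) (auto simp: less_eq_vec_def)
  next
    assume "\<exists>x\<ge>0. \<gamma> - \<delta> = A *v x"
    then obtain x where "0 \<le> x" "\<gamma> - \<delta> = A *v x" by blast
    then show "weight_ge A \<gamma> \<delta>"
      unfolding weight_ge_def sum[symmetric]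
      by (intro exI[of _ "\<lambda>i. nat (x $ i)"]) (simp add: less_eq_vec_def)
  qed
qed

text \<open>By \<open>chain_step\<close> a descent of weights means positivity of the orbit of
  \<open>beta k\<close>. An admissible \<open>m\<close> makes that orbit negative, so
  \<open>h k \<le> m\<close>; if \<open>h k < m\<close>, the root at time \<open>h k\<close> would
  have both signs.\<close>

lemma cox_h_eq: "cox_h A (word_elt A ws) k = h k"
proof -
  have gt: "weight_gt A (word_elt A (power_word m) (e k)) (word_elt A (power_word (Suc m)) (e k)) \<longleftrightarrow>
      0 \<le> act (power_word m) (beta k)" for m
  proof -
    have "act (power_word m) (beta k) \<noteq> 0" using root_act[OF root_beta] by (auto simp: is_root_def)
    then have "A *v act (power_word m) (beta k) \<noteq> 0" using A_inj A_zero by metis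
    then show ?thesis unfolding weight_gt_def weight_ge_iff
      using chain_step[of m k] A_inj by (metis right_minus_eq)
  qed
  show ?thesis
    unfolding cox_h_def funpow_word fund_weight_def gt
  proof (rule the_equality)
    fix m assume m: "0 < m \<and> (\<forall>l<m. 0 \<le> act (power_word l) (beta k)) \<and>
      word_elt A (power_word m) (e k) = - e (star A k)"
    have "A *v act (power_word m) (beta k) = A *v (- beta (star A k))"
      unfolding chain_step[symmetric] A_minus A_beta using m
      by (simp add: power_word_Suc word_append word_minus)
    then have "act (power_word m) (beta k) = - beta (star A k)" by (rule A_inj)
    then have "act (power_word m) (beta k) \<le> 0"
      using beta_nonneg[of "star A k"] by (simp add: less_eq_vec_def)
    then have "h k \<le> m" by (rule h_le)
    moreover have "\<not> h k < m"
    proof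
      assume "h k < m"
      then have "act (power_word (h k)) (beta k) = 0" using m act_h by (simp add: order_antisym)
      then show False using root_act[OF root_beta, of "power_word (h k)" k] by (simp add: is_root_def)
    qed
    ultimately show "m = h k" by simp
  qed (use h_pos act_less_h chain_end_star in auto)
qed

section \<open>The involution \<open>star\<close> preserves adjacency\<close>

lemma star_inj: "star A i = star A j \<Longrightarrow> i = j"
proof -
  assume "star A i = star A j"
  then have "longest_elt A (e i) = longest_elt A (e j)" by (simp add: longest_star)
  moreover obtain us where "longest_elt A = word_elt A us" by (rule longest_word)
  ultimately have "e i = e j" by (metis word_rev(1))
  then show ?thesis by (simp add: axis_eq_axis)
qed

text \<open>Pairing with the images \<open>- e (star A l)\<close> of the fundamental weights kills
  every coordinate except \<open>star A i\<close>, as \<open>star\<close> is surjective.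
  \<open>root_reflect_neg\<close> then fixes the multiple.\<close>

lemma act_longest:
  assumes "longest_elt A = word_elt A us" "act us (e i) \<le> 0"
  shows "act us (e i) = - e (star A i)"
proof -
  have 0: "act us (e i) $ star A l = 0" if "l \<noteq> i" for l
  proof -
    have "d (star A l) * of_int (act us (e i) $ star A l) = - pairing (word_elt A us (e l)) (act us (e i))"
      by (simp add: pairing_minus_left pairing_e_left longest_star flip: assms(1))
    also have "\<dots> = 0" using that by (simp add: pairing_act pairing_e_left e_nth)
    finally show ?thesis using d_pos[of "star A l"] by simp
  qed
  have "surj (star A)" using star_inj by (intro finite_UNIV_inj_surj injI) auto
  then have 0: "act us (e i) $ l = 0" if "l \<noteq> star A i" for l
    using 0 that by (metis surjD)
  \<comment> \<open>The extra letter negates \<open>e i\<close>, which presents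
    \<open>- act us (e i)\<close> as a word image and hence as a root.\<close>
  define x where "x = act (us @ [i]) (e i)"
  have x: "x = - act us (e i)" by (simp add: x_def act_append reflect_e act_minus)
  have "0 \<le> x" using assms(2) by (simp add: x less_eq_vec_def)
  have "x = x $ star A i *s e (star A i)" using 0 by (simp add: vec_eq_iff e_nth x)
  then have "reflect (star A i) x = - x" by (metis reflect_scale reflect_e vector_smult_rneg)
  then have "x = e (star A i)"
    using \<open>0 \<le> x\<close> by (intro root_reflect_neg) (auto simp: x_def root_act root_e less_eq_vec_def)
  then show ?thesis using x by (simp add: minus_equation_iff)
qed

lemma adjacent_star: "A $ star A i $ star A j = 0 \<longleftrightarrow> A $ i $ j = 0"
proof -
  obtain us where us: "longest_elt A = word_elt A us" "\<And>i. act us (e i) \<le> 0"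
    using longest_word by blast
  have "pairing (A *v act us (e j)) (act us (e i)) = pairing (A *v e j) (e i)"
    by (simp add: A_act pairing_act)
  then have "d (star A i) * of_int (A $ star A i $ star A j) = d i * of_int (A $ i $ j)"
    by (simp add: act_longest[OF us(1) us(2)] A_minus pairing_minus_left pairing_minus_right
        pairing_e_right A_e_nth)
  then show ?thesis using d_pos[of i] d_pos[of "star A i"] by auto
qed

section \<open>Coefficients that detect the order of the letters\<close>

lemma beta_pos:
  assumes "i \<in> set (before j)" "A $ i $ j \<noteq> 0"
  shows "0 < beta j $ i"
proof -
  obtain vs xs where "before j = before i @ i # vs" "i \<notin> set vs" "i \<noteq> j" "j \<notin> set vs" "i \<notin> set (before i)"
    using before_split[OF assms(1)] by metis
  then show ?thesis unfolding beta_def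
    using assms(2) by (auto intro!: coeff_pos root_e simp: e_nth)
qed

text \<open>\<open>beta i\<close> has coefficient 1 at \<open>i\<close> and 0 at \<open>j\<close>.
  Letters after \<open>j\<close> preserve both, so \<open>coeff_pos\<close> applies at the letter
  \<open>j\<close>.\<close>

lemma act_ws_beta_pos:
  assumes "i \<in> set (before j)" "A $ i $ j \<noteq> 0"
  shows "0 < act ws (beta i) $ j"
proof -
  obtain vs xs where s: "ws = before i @ i # vs @ j # xs"
    "j \<notin> set (before i)" "j \<notin> set xs" "i \<notin> set xs" "i \<noteq> j" "j \<notin> set vs"
    using before_split[OF assms(1)] by metis
  have "0 < act ((before i @ i # vs) @ j # xs) (beta i) $ j"
    using s(2-) assms(2) zero_sym[of i j]
    by (intro coeff_pos[of _ i] root_beta) (auto simp: beta_diag beta_nth_zero)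
  then show ?thesis using s(1) by simp
qed

text \<open>By \<open>A_beta\<close> the vectors \<open>beta\<close> depend only on
  \<open>c\<close>. An order seen in another factorization makes the coefficient of
  \<open>beta j\<close> at \<open>i\<close> positive, which forces the same order in
  \<open>ws\<close>.\<close>

lemma cox_prec_iff:
  "cox_prec A (word_elt A ws) i j \<longleftrightarrow> A $ i $ j \<noteq> 0 \<and> i \<in> set (before j)"
proof
  assume "cox_prec A (word_elt A ws) i j"
  then obtain us p q where *: "i \<noteq> j" "A $ i $ j \<noteq> 0" "distinct us" "set us = UNIV"
    "word_elt A ws = word_elt A us" "p < q" "q < length us" "us ! p = i" "us ! q = j"
    unfolding cox_prec_def coxeter_factorization_def by blast
  interpret other: coxeter A d us using * by unfold_locales
  have us: "us = take q us @ j # drop (Suc q) us" using * id_take_nth_drop by metis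
  have "i \<in> set (take q us)" using * by (auto simp: in_set_conv_nth intro!: exI[of _ p])
  then have "i \<in> set (other.before j)" using other.before_eq[OF us] by simp
  then have "0 < other.beta j $ i" using * by (intro other.beta_pos)
  also have "other.beta j = beta j" by (rule A_inj) (simp add: other.A_beta A_beta *)
  finally show "A $ i $ j \<noteq> 0 \<and> i \<in> set (before j)" using * beta_nth_zero[of i j] by auto
next
  assume *: "A $ i $ j \<noteq> 0 \<and> i \<in> set (before j)"
  obtain vs where vs: "ws = before j @ j # vs" "j \<notin> set (before j)" by (rule ws_split)
  obtain p where p: "p < length (before j)" "before j ! p = i" using * by (metis in_set_conv_nth)
  have "ws ! p = i"
    using arg_cong[OF vs(1), of "\<lambda>xs. xs ! p"] p by (simp add: nth_append)
  moreover have "ws ! length (before j) = j"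
    using arg_cong[OF vs(1), of "\<lambda>xs. xs ! length (before j)"] by simp
  moreover have "length (before j) < length ws"
    using arg_cong[OF vs(1), of length] by simp
  moreover have "i \<noteq> j" using * vs by auto
  ultimately show "cox_prec A (word_elt A ws) i j"
    unfolding cox_prec_def coxeter_factorization_def using * p(1) distinct_ws set_ws
    by (intro conjI exI[of _ ws] exI[of _ p] exI[of _ "length (before j)"]) simp_all
qed

section \<open>Comparison of the two orbit lengths\<close>

lemma pairing_shift:
  "d (star A i) * of_int (act (power_word (h i)) x $ star A i) = - (d i * of_int (x $ i))"
  using pairing_act[of "power_word (h i)" "e i" x]
  by (simp add: chain_end_star pairing_minus_left pairing_e_left)

lemma nth_shift_neg: "0 < x $ i \<Longrightarrow> act (power_word (h i)) x $ star A i < 0"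
proof -
  assume "0 < x $ i"
  then have "d (star A i) * of_int (act (power_word (h i)) x $ star A i) < 0"
    unfolding pairing_shift using d_pos[of i] by simp
  then show ?thesis using d_pos[of "star A i"] by (simp add: mult_less_0_iff)
qed

lemma h_difference:
  assumes "i \<in> set (before j)" "A $ i $ j \<noteq> 0"
  shows "h i = h j \<and> star A i \<in> set (before (star A j)) \<or>
         h i = Suc (h j) \<and> star A j \<in> set (before (star A i))"
proof -
  have neq: "star A i \<noteq> star A j" using star_inj before_asym assms(1) by metis
  have neg1: "act (power_word (h i)) (beta j) $ star A i < 0"
    using assms by (intro nth_shift_neg beta_pos)
  \<comment> \<open>The shift by \<open>h j\<close> is applied to \<open>c\<close> times
    \<open>beta i\<close>; this extra factor is the source of \<open>Suc (h j)\<close>.\<close>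
  have "act (power_word (h j)) (act ws (beta i)) $ star A j < 0"
    using assms by (intro nth_shift_neg act_ws_beta_pos)
  then have neg2: "act (power_word (Suc (h j))) (beta i) $ star A j < 0"
    by (simp add: power_word_Suc' act_append)
  have "h j \<le> h i" using neg1 root_nonpos root_act root_beta by (intro h_le) blast
  moreover have "h i \<le> Suc (h j)" using neg2 root_nonpos root_act root_beta by (intro h_le) blast
  ultimately consider "h i = h j" | "h i = Suc (h j)" by linarith
  then show ?thesis
  proof cases
    case 1
    then have "beta (star A j) $ star A i \<noteq> 0" using neg1 by (simp add: act_h_beta)
    then show ?thesis using 1 neq beta_nth_zero by metis
  next
    case 2
    \<comment> \<open>Here \<open>Suc (h j)\<close> is \<open>h i\<close>, so \<open>neg2\<close>
      concerns the end of the orbit of \<open>beta i\<close>, which is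
      \<open>- beta (star A i)\<close>.\<close>
    then have "beta (star A i) $ star A j \<noteq> 0" using neg2 by (simp add: act_h_beta flip: 2)
    then show ?thesis using 2 neq beta_nth_zero by metis
  qed
qed

end

theorem proposition1p6:
  fixes A :: "int ^ 'i ^ 'i::finite"
    and c :: "int ^ 'i \<Rightarrow> int ^ 'i"
    and i j :: 'i
  assumes "finite_type A"
    and "coxeter_element A c"
    and "cox_prec A c i j"
  shows "(cox_prec A c (star A j) (star A i) \<or> cox_prec A c (star A i) (star A j)) \<and>
         (cox_prec A c (star A j) (star A i) \<longrightarrow> int (cox_h A c i) - int (cox_h A c j) = 1) \<and>
         (cox_prec A c (star A i) (star A j) \<longrightarrow> int (cox_h A c i) - int (cox_h A c j) = 0)"
proof -
  obtain d where "finite_cartan A d"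
    using assms(1) unfolding finite_type_def finite_cartan_def by blast
  moreover obtain ws where ws: "distinct ws" "set ws = UNIV" "c = word_elt A ws"
    using assms(2) unfolding coxeter_element_def coxeter_factorization_def by blast
  ultimately interpret coxeter A d ws by (simp add: coxeter_def coxeter_axioms_def)
  have ij: "A $ i $ j \<noteq> 0" "i \<in> set (before j)" using assms(3) by (simp_all add: ws(3) cox_prec_iff)
  \<comment> \<open>Adjacency of the starred indices turns their order in \<open>ws\<close> into
    \<open>cox_prec\<close>, and \<open>before_asym\<close> excludes the opposite order.\<close>
  have "A $ star A i $ star A j \<noteq> 0" "A $ star A j $ star A i \<noteq> 0"
    using ij(1) zero_sym[of i j] by (simp_all add: adjacent_star)
  then show ?thesis
    using h_difference[OF ij(2,1)] before_asym by (auto simp: ws(3) cox_prec_iff cox_h_eq)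
qed

end
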